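(* Let $m\ge 1$ and $N\ge 0$ be integers, and let $\Delta_\Phi:\ell_{2e}^m\to\ell_{2e}^m$ be the repeated nonlinearity defined by the scalar ReLU. Let $\{Q^1_i\}_{i=0}^N$, $\{Q^2_i\}_{i=0}^N$, $\{Q^3_i\}_{i=-N}^{-1}$, $\{Q^3_i\}_{i=1}^{N}$ be given matrices in $\mathbb{R}_{\ge 0}^{m\times m}$ (entrywise non-negative), and let $Q^3_0\in\mathbb{R}^{m\times m}$ be a Metzler matrix. Then $\Delta_\Phi$ satisfies the time-domain hard IQC defined by $(\Psi_N,M)$, where $$M:=\begin{bmatrix} M_1 & -M_3^\top-M_1\\ -M_3-M_1 & M_1+M_2+M_3+M_3^\top\end{bmatrix}$$ with the $m(N+1)\times m(N+1)$ matrices $$M_j:=\begin{bmatrix} Q^j_0 & Q^j_1 & \cdots & Q^j_N\\ Q^j_1 & 0 & \cdots & 0\\ \vdots & \vdots & & \vdots\\ Q^j_N & 0 & \cdots & 0\end{bmatrix}\ (j=1,2),\qquad M_3:=\begin{bmatrix} Q^3_0 & Q^3_1 & \cdots & Q^3_N\\ Q^3_{-1} & 0 & \cdots & 0\\ \vdots & \vdots & & \vdots\\ Q^3_{-N} & 0 & \cdots & 0\end{bmatrix}.$$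
   Context: Signals are sequences indexed by $k\in\mathbb{N}=\{0,1,2,\dots\}$; $\ell_{2e}^m$ denotes the extended space of sequences $v:\mathbb{N}\to\mathbb{R}^m$ whose $\ell_2$ norm is not necessarily finite. Repeated ReLU: the scalar ReLU is $\phi(s)=0$ for $s<0$ and $\phi(s)=s$ for $s\ge 0$. The function $\Phi:\mathbb{R}^m\to\mathbb{R}^m_{\ge 0}$ applies $\phi$ to each entry, and $\Delta_\Phi$ is defined by $(\Delta_\Phi(v))(k)=\Phi(v(k))$ for every $k\in\mathbb{N}$. A matrix $A\in\mathbb{R}^{m\times m}$ is Metzler if $A_{ij}\ge 0$ for all $i\neq j$. The filter $\Psi_N$ is the finite impulse response filter with inputs $v,w$ (each $\mathbb{R}^m$-valued) whose output from zero initial conditions is $$r(k)=\big[v(k)^\top,\,v(k-1)^\top,\dots,v(k-N)^\top,\;w(k)^\top,\,w(k-1)^\top,\dots,w(k-N)^\top\big]^\top\in\mathbb{R}^{2m(N+1)},$$ with $v(j)=0$ and $w(j)=0$ for $j<0$. Time-domain (hard) IQC: let $\Psi$ be a stable rational filter with $2m$ inputs and $n_r$ outputs and let $M$ be a real symmetric $n_r\times n_r$ matrix. The operator $\Delta_\Phi$ satisfies the time-domain IQC defined by $(\Psi,M)$ if for all $v\in\ell_{2e}^m$ and all $T_0\ge 0$, $$\sum_{k=0}^{T_0} r(k)^\top M\,r(k)\ge 0,$$ where $r$ is the output of $\Psi$ from zero initial conditions driven by the inputs $(v,w)$ with $w=\Delta_\Phi(v)$. It is called hard because the inequality holds for all $T_0\ge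 0$. *)

theory Defs
  imports
    Complex_Main
    "HOL-Computational_Algebra.Polynomial_FPS"
    "Jordan_Normal_Form.Matrix"
begin

type_synonym signal = "nat \<Rightarrow> real vec"

text \<open>Extended signal space: every sequence with values in dimension \<open>m\<close>, with no norm bound.\<close>

definition ell2e :: "nat \<Rightarrow> signal set" where
  "ell2e m = {v. \<forall>k. v k \<in> carrier_vec m}"

definition relu :: "real \<Rightarrow> real" where
  "relu s = (if s < 0 then 0 else s)"

definition relu_vec :: "real vec \<Rightarrow> real vec" where
  "relu_vec = map_vec relu"

definition repeated_relu :: "signal \<Rightarrow> signal" where
  "repeated_relu v = (\<lambda>k. relu_vec (v k))"

definition nonneg_mat :: "real mat \<Rightarrow> bool" where
  "nonneg_mat A \<longleftrightarrow> (\<forall>i<dim_row A. \<forall>j<dim_col A. 0 \<le> A $$ (i, j))"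

definition metzler :: "real mat \<Rightarrow> bool" where
  "metzler A \<longleftrightarrow> square_mat A \<and>
     (\<forall>i<dim_row A. \<forall>j<dim_col A. i \<noteq> j \<longrightarrow> 0 \<le> A $$ (i, j))"

text \<open>A filter maps the two input signals to the output signal from zero initial conditions.\<close>

type_synonym filt = "signal \<Rightarrow> signal \<Rightarrow> signal"

text \<open>
  \<open>H\<close> is the impulse response, so \<open>\<Psi>\<close> is convolution with \<open>H\<close> and its transfer function is the
  sum of \<open>H k * z^(-k)\<close>. In the variable \<open>x = z^(-1)\<close> each entry is required to be the power
  series of a real rational function \<open>p / q\<close>. Poles in \<open>\<bar>z\<bar> < 1\<close> means that \<open>q\<close> has no
  root in \<open>\<bar>x\<bar> \<le> 1\<close>; the case \<open>x = 0\<close> is properness.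
\<close>

definition stable_rational_filter :: "nat \<Rightarrow> nat \<Rightarrow> filt \<Rightarrow> bool" where
  "stable_rational_filter m nr \<Psi> \<longleftrightarrow>
     (\<exists>H :: nat \<Rightarrow> real mat.
        (\<forall>k. H k \<in> carrier_mat nr (2 * m)) \<and>
        (\<forall>i<nr. \<forall>j<2 * m. \<exists>p q :: real poly.
           (\<forall>x::complex. cmod x \<le> 1 \<longrightarrow> poly (map_poly complex_of_real q) x \<noteq> 0) \<and>
           fps_of_poly q * Abs_fps (\<lambda>k. H k $$ (i, j)) = fps_of_poly p) \<and>
        (\<forall>v\<in>ell2e m. \<forall>w\<in>ell2e m. \<forall>k.
           \<Psi> v w k = vec nr (\<lambda>i. \<Sum>l\<le>k. (H l *\<^sub>v (v (k - l) @\<^sub>v w (k - l))) $ i)))"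

text \<open>
  Symmetry of \<open>M\<close> is not imposed: the quadratic form only depends on the symmetric part of \<open>M\<close>,
  and the matrix \<open>relu_iqc_mat\<close> below is not symmetric when \<open>Q1 i\<close> or \<open>Q2 i\<close> is not.
\<close>

definition satisfies_hard_iqc ::
    "nat \<Rightarrow> nat \<Rightarrow> (signal \<Rightarrow> signal) \<Rightarrow> filt \<Rightarrow> real mat \<Rightarrow> bool" where
  "satisfies_hard_iqc m nr \<Delta> \<Psi> M \<longleftrightarrow>
     stable_rational_filter m nr \<Psi> \<and> M \<in> carrier_mat nr nr \<and>
     (\<forall>v\<in>ell2e m. \<forall>T0. 0 \<le> (\<Sum>k\<le>T0. \<Psi> v (\<Delta> v) k \<bullet> (M *\<^sub>v \<Psi> v (\<Delta> v) k)))"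

definition delayed :: "nat \<Rightarrow> signal \<Rightarrow> nat \<Rightarrow> nat \<Rightarrow> real vec" where
  "delayed m v k i = (if i \<le> k then v (k - i) else 0\<^sub>v m)"

text \<open>The stacked vector \<open>[v(k); v(k-1); ...; v(k-N)]\<close>; block \<open>i\<close> occupies the
  indices \<open>i * m, ..., i * m + m - 1\<close>.\<close>

definition delay_stack :: "nat \<Rightarrow> nat \<Rightarrow> signal \<Rightarrow> nat \<Rightarrow> real vec" where
  "delay_stack m N v k = vec (m * (N + 1)) (\<lambda>s. delayed m v k (s div m) $ (s mod m))"

definition fir_filter :: "nat \<Rightarrow> nat \<Rightarrow> filt" where
  "fir_filter m N v w k = delay_stack m N v k @\<^sub>v delay_stack m N w k"

text \<open>Block matrix of \<open>m \<times> m\<close> blocks with first block row \<open>R 0, ..., R N\<close>, first block column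
  \<open>R 0, C 1, ..., C N\<close>, and zero elsewhere (\<open>C 0\<close> is not used).\<close>

definition bordered_mat :: "nat \<Rightarrow> nat \<Rightarrow> (nat \<Rightarrow> real mat) \<Rightarrow> (nat \<Rightarrow> real mat) \<Rightarrow> real mat" where
  "bordered_mat m N R C = mat (m * (N + 1)) (m * (N + 1)) (\<lambda>(s, t).
     if s div m = 0 then R (t div m) $$ (s mod m, t mod m)
     else if t div m = 0 then C (s div m) $$ (s mod m, t mod m)
     else 0)"

definition relu_iqc_mat ::
    "nat \<Rightarrow> nat \<Rightarrow> (nat \<Rightarrow> real mat) \<Rightarrow> (nat \<Rightarrow> real mat) \<Rightarrow> (int \<Rightarrow> real mat) \<Rightarrow> real mat" where
  "relu_iqc_mat m N Q1 Q2 Q3 =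
     (let M1 = bordered_mat m N Q1 Q1;
          M2 = bordered_mat m N Q2 Q2;
          M3 = bordered_mat m N (\<lambda>i. Q3 (int i)) (\<lambda>i. Q3 (- int i))
      in four_block_mat
           M1          (- M3\<^sup>T - M1)
           (- M3 - M1) (M1 + M2 + M3 + M3\<^sup>T))"

end

theory Submission
  imports Defs
begin

text \<open>
  Write \<open>V\<close>, \<open>W\<close> for the stacked delays of \<open>v\<close> and \<open>w = \<Delta>\<^sub>\<Phi>(v)\<close>, and \<open>U = W - V\<close>. Each single term
  \<open>r(k)\<^sup>T M r(k)\<close> equals \<open>U\<^sup>T M\<^sub>1 U + W\<^sup>T M\<^sub>2 W + 2 W\<^sup>T M\<^sub>3 U\<close>. The ReLU gives \<open>W \<ge> 0\<close>, \<open>U \<ge> 0\<close> and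
  \<open>W\<^sub>s U\<^sub>s = 0\<close> for every \<open>s\<close>, so the first two terms are non-negative because \<open>M\<^sub>1\<close>, \<open>M\<^sub>2\<close> are
  entrywise non-negative, and in the third one the diagonal of \<open>M\<^sub>3\<close>, the only place where
  negative entries may occur, does not contribute.
\<close>

lemma bilinear_form_sum:
  fixes A :: "real mat"
  assumes "A \<in> carrier_mat n n" "x \<in> carrier_vec n" "y \<in> carrier_vec n"
  shows "x \<bullet> (A *\<^sub>v y) = (\<Sum>i<n. \<Sum>j<n. A $$ (i, j) * (x $ i * y $ j))"
  using assms
  by (auto simp: scalar_prod_def sum_distrib_left atLeast0LessThan mult_ac intro!: sum.cong)

text \<open>In the double sum the diagonal entries of \<open>A\<close>, whose sign is unknown, are
  multiplied by \<open>x $ i * y $ i = 0\<close>; all other terms are products of non-negative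
  numbers.\<close>

lemma metzler_form_nonneg:
  assumes A: "A \<in> carrier_mat n n" "metzler A"
    and x: "x \<in> carrier_vec n" "\<And>i. i < n \<Longrightarrow> 0 \<le> x $ i"
    and y: "y \<in> carrier_vec n" "\<And>i. i < n \<Longrightarrow> 0 \<le> y $ i"
    and compl: "\<And>i. i < n \<Longrightarrow> x $ i * y $ i = 0"
  shows "0 \<le> x \<bullet> (A *\<^sub>v y)"
  unfolding bilinear_form_sum[OF A(1) x(1) y(1)]
proof (intro sum_nonneg)
  fix i j assume "i \<in> {..<n}" "j \<in> {..<n}"
  then show "0 \<le> A $$ (i, j) * (x $ i * y $ j)"
    using A x(2) y(2) compl[of i] by (cases "i = j") (auto simp: metzler_def)
qed

lemma nonneg_form_nonneg:
  assumes A: "A \<in> carrier_mat n n" "nonneg_mat A"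
    and x: "x \<in> carrier_vec n" "\<And>i. i < n \<Longrightarrow> 0 \<le> x $ i"
    and y: "y \<in> carrier_vec n" "\<And>i. i < n \<Longrightarrow> 0 \<le> y $ i"
  shows "0 \<le> x \<bullet> (A *\<^sub>v y)"
  unfolding bilinear_form_sum[OF A(1) x(1) y(1)]
  using A x(2) y(2) by (auto simp: nonneg_mat_def intro!: sum_nonneg)

text \<open>The transposed block contributes the same scalar as \<open>C\<close> with its arguments
  exchanged, so the \<open>C\<close> terms pair up into twice
  \<open>y \<bullet> (C *\<^sub>v (y - x))\<close>. The two off-diagonal copies of
  \<open>- A\<close> supply the two cross terms of the form in \<open>y - x\<close>, which differ
  when \<open>A\<close> is not symmetric.\<close>

lemma block_form_expand:
  fixes A B C :: "real mat"
  assumes A: "A \<in> carrier_mat n n" and B: "B \<in> carrier_mat n n" and C: "C \<in> carrier_mat n n"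
    and x: "x \<in> carrier_vec n" and y: "y \<in> carrier_vec n"
  shows "(x @\<^sub>v y) \<bullet> (four_block_mat A (- C\<^sup>T - A) (- C - A) (A + B + C + C\<^sup>T) *\<^sub>v (x @\<^sub>v y)) =
    (y - x) \<bullet> (A *\<^sub>v (y - x)) + y \<bullet> (B *\<^sub>v y) + 2 * (y \<bullet> (C *\<^sub>v (y - x)))"
proof -
  \<comment> \<open>Working with scalar double sums reduces the block identity to linearity and
    confines most of the dimension conditions to the translation \<open>f\<close>.\<close>
  define f where "f M u w = (\<Sum>i<n. \<Sum>j<n. M $$ (i, j) * (u $ i * w $ j))"
    for M :: "real mat" and u w :: "real vec"
  have f: "u \<bullet> (M *\<^sub>v w) = f M u w"
    if "M \<in> carrier_mat n n" "u \<in> carrier_vec n" "w \<in> carrier_vec n" for M u w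
    using bilinear_form_sum[OF that] by (simp add: f_def)
  have CT: "f (C\<^sup>T) u w = f C w u" for u w
    unfolding f_def using C by (subst sum.swap) (auto intro!: sum.cong)
  have diff: "f M (u - u') w = f M u w - f M u' w" "f M w (u - u') = f M w u - f M w u'"
    if "u \<in> carrier_vec n" "u' \<in> carrier_vec n" for M u u' w
    using that by (auto simp: f_def algebra_simps sum_subtractf[symmetric] intro!: sum.cong)
  have blk: "f (- C\<^sup>T - A) u w = - f (C\<^sup>T) u w - f A u w" "f (- C - A) u w = - f C u w - f A u w"
    "f (A + B + C + C\<^sup>T) u w = f A u w + f B u w + f C u w + f (C\<^sup>T) u w" for u w
    using A B C
    by (auto simp: f_def algebra_simps sum_subtractf[symmetric] sum.distrib[symmetric]
        sum_negf[symmetric] intro!: sum.cong)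
  have c: "- C\<^sup>T - A \<in> carrier_mat n n" "- C - A \<in> carrier_mat n n"
    "A + B + C + C\<^sup>T \<in> carrier_mat n n"
    using A B C by auto
  have "(x @\<^sub>v y) \<bullet> (four_block_mat A (- C\<^sup>T - A) (- C - A) (A + B + C + C\<^sup>T) *\<^sub>v (x @\<^sub>v y)) =
      x \<bullet> (A *\<^sub>v x + (- C\<^sup>T - A) *\<^sub>v y) + y \<bullet> ((- C - A) *\<^sub>v x + (A + B + C + C\<^sup>T) *\<^sub>v y)"
    using A c x y
    by (subst four_block_mat_mult_vec[of _ n n _ n _ n]) (auto intro!: scalar_prod_append)
  also have "\<dots> = f A x x + f (- C\<^sup>T - A) x y + (f (- C - A) y x + f (A + B + C + C\<^sup>T) y y)"
    using A c x y
    by (simp add: f[symmetric] scalar_prod_add_distrib[of _ n] mult_mat_vec_carrier[of _ n n])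
  also have "\<dots> = f A (y - x) (y - x) + f B y y + 2 * f C y (y - x)"
    using x y by (simp add: blk CT diff)
  finally show ?thesis
    using A B C x y by (simp add: f)
qed

lemma bordered_mat_carrier [simp]: "bordered_mat m N R C \<in> carrier_mat (m * (N + 1)) (m * (N + 1))"
  by (simp add: bordered_mat_def)

lemma bordered_mat_nonneg:
  assumes "m \<ge> 1"
    and "\<And>i. i \<le> N \<Longrightarrow> R i \<in> carrier_mat m m \<and> nonneg_mat (R i)"
    and "\<And>i. 1 \<le> i \<Longrightarrow> i \<le> N \<Longrightarrow> C i \<in> carrier_mat m m \<and> nonneg_mat (C i)"
  shows "nonneg_mat (bordered_mat m N R C)"
proof -
  \<comment> \<open>The block index stays in the range where the hypotheses on \<open>R\<close> and
    \<open>C\<close> apply.\<close>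
  have "t div m \<le> N" if "t < m * (N + 1)" for t
    using less_mult_imp_div_less[of t "N + 1" m] that by (simp add: mult.commute)
  moreover have "0 \<le> R i $$ (a, b)" if "i \<le> N" "a < m" "b < m" for i a b
    using assms(2)[of i] that by (auto simp: nonneg_mat_def)
  moreover have "0 \<le> C i $$ (a, b)" if "1 \<le> i" "i \<le> N" "a < m" "b < m" for i a b
    using assms(3)[of i] that by (auto simp: nonneg_mat_def)
  ultimately show ?thesis
    using assms(1) by (simp add: bordered_mat_def nonneg_mat_def Suc_le_eq)
qed

lemma bordered_mat_metzler:
  assumes "m \<ge> 1" "R 0 \<in> carrier_mat m m" "metzler (R 0)"
    and "\<And>i. 1 \<le> i \<Longrightarrow> i \<le> N \<Longrightarrow> R i \<in> carrier_mat m m \<and> nonneg_mat (R i)"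
    and "\<And>i. 1 \<le> i \<Longrightarrow> i \<le> N \<Longrightarrow> C i \<in> carrier_mat m m \<and> nonneg_mat (C i)"
  shows "metzler (bordered_mat m N R C)"
proof -
  have bnd: "t div m \<le> N" if "t < m * (N + 1)" for t
    using less_mult_imp_div_less[of t "N + 1" m] that by (simp add: mult.commute)
  have R: "0 \<le> R i $$ (a, b)" if "1 \<le> i" "i \<le> N" "a < m" "b < m" for i a b
    using assms(4)[of i] that by (auto simp: nonneg_mat_def)
  have C: "0 \<le> C i $$ (a, b)" if "1 \<le> i" "i \<le> N" "a < m" "b < m" for i a b
    using assms(5)[of i] that by (auto simp: nonneg_mat_def)
  have "0 \<le> bordered_mat m N R C $$ (s, t)"
    if s: "s < m * (N + 1)" and t: "t < m * (N + 1)" and "s \<noteq> t" for s t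
  proof (cases "s div m = 0 \<and> t div m = 0")
    case True
    \<comment> \<open>In the corner block \<open>s mod m = s\<close> and \<open>t mod m = t\<close>,
      so \<open>s \<noteq> t\<close> selects an off-diagonal entry of \<open>R 0\<close>. Outside
      it, every entry is zero or comes from a non-negative block.\<close>
    then have "s < m" "t < m" using \<open>m \<ge> 1\<close> by (auto simp: div_eq_0_iff)
    then show ?thesis using assms that True by (auto simp: bordered_mat_def metzler_def)
  next
    case False
    then show ?thesis
      using assms(1) s t bnd[OF s] bnd[OF t] R C
      by (auto simp: bordered_mat_def Suc_le_eq)
  qed
  then show ?thesis
    by (auto simp: metzler_def bordered_mat_def)
qed

lemma delay_stack_carrier [simp]: "delay_stack m N v k \<in> carrier_vec (m * (N + 1))"
  by (simp add: delay_stack_def)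

text \<open>Stacking commutes with the ReLU even at times before zero, because
  \<open>relu 0 = 0\<close> maps the zero padding of \<open>v\<close> to that of
  \<open>w\<close>.\<close>

lemma delay_stack_repeated_relu:
  assumes "m \<ge> 1" "v \<in> ell2e m" "s < m * (N + 1)"
  shows "delay_stack m N (repeated_relu v) k $ s = relu (delay_stack m N v k $ s)"
proof -
  have "dim_vec (v j) = m" for j
    using assms(2) by (auto simp: ell2e_def)
  then show ?thesis
    using assms by (auto simp: delay_stack_def delayed_def repeated_relu_def relu_vec_def relu_def)
qed

text \<open>Every output is a delayed copy of one input, so each entry of the transfer function is
  zero or a power of the delay variable.\<close>

lemma fir_filter_stable:
  assumes m: "m \<ge> 1"
  shows "stable_rational_filter m (2 * m * (N + 1)) (fir_filter m N)"
proof -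
  let ?n = "m * (N + 1)"
  \<comment> \<open>Output entry \<open>i\<close> is entry \<open>src i\<close> of the stacked input \<open>[v; w]\<close>, delayed by \<open>lag i\<close>.\<close>
  define lag where "lag i = (i mod ?n) div m" for i
  define src where "src i = i mod m + (if i < ?n then 0 else m)" for i
  define H :: "nat \<Rightarrow> real mat" where
    "H l = mat (2 * ?n) (2 * m) (\<lambda>(i, j). if l = lag i \<and> j = src i then 1 else 0)" for l
  have src: "src i < 2 * m" for i
    using m mod_less_divisor[of m i] by (simp add: src_def del: mod_less_divisor)
  \<comment> \<open>For fixed \<open>(i, j)\<close> the impulse response is zero or a unit pulse at
    time \<open>lag i\<close>. The numerator is then \<open>0\<close> or a monomial of degree
    \<open>lag i\<close>, over the root-free denominator \<open>1\<close>.\<close>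
  have rat: "\<exists>p q :: real poly.
      (\<forall>x::complex. cmod x \<le> 1 \<longrightarrow> poly (map_poly complex_of_real q) x \<noteq> 0) \<and>
      fps_of_poly q * Abs_fps (\<lambda>k. H k $$ (i, j)) = fps_of_poly p"
    if "i < 2 * ?n" "j < 2 * m" for i j
    using that
    by (intro exI[of _ "if j = src i then monom 1 (lag i) else 0"] exI[of _ 1])
       (auto simp: H_def fps_eq_iff)
  have conv: "fir_filter m N v w k =
      vec (2 * ?n) (\<lambda>i. \<Sum>l\<le>k. (H l *\<^sub>v (v (k - l) @\<^sub>v w (k - l))) $ i)"
    if "v \<in> ell2e m" "w \<in> ell2e m" for v w k
  proof (rule eq_vecI)
    fix i assume "i < dim_vec (vec (2 * ?n) (\<lambda>i. \<Sum>l\<le>k. (H l *\<^sub>v (v (k - l) @\<^sub>v w (k - l))) $ i))"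
    then have i: "i < 2 * ?n" by simp
    have dims: "dim_vec (v j) = m" "dim_vec (w j) = m" for j
      using that by (auto simp: ell2e_def)
    have "j mod m < m" for j
      using m by simp
    then have app: "(v a @\<^sub>v w b) $ (j mod m) = v a $ (j mod m)"
      "(v a @\<^sub>v w b) $ (j mod m + m) = w b $ (j mod m)" for a b j
      using dims by (simp_all add: trans_less_add1)
    have "(H l *\<^sub>v (v (k - l) @\<^sub>v w (k - l))) $ i =
        (if l = lag i then (v (k - l) @\<^sub>v w (k - l)) $ src i else 0)" for l
    proof -
      let ?x = "v (k - l) @\<^sub>v w (k - l)"
      have "(H l *\<^sub>v ?x) $ i = (\<Sum>j<2 * m. H l $$ (i, j) * ?x $ j)"
        using i dims by (simp add: H_def scalar_prod_def atLeast0LessThan mult_2)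
      also have "\<dots> = (\<Sum>j<2 * m. if j = src i then (if l = lag i then ?x $ j else 0) else 0)"
        using i by (intro sum.cong) (simp_all add: H_def)
      also have "\<dots> = (if l = lag i then ?x $ src i else 0)"
        using src by simp
      finally show ?thesis .
    qed
    \<comment> \<open>Only \<open>l = lag i\<close> survives. If it exceeds \<open>k\<close> the sum
      is empty of nonzero terms, which matches the zero initial conditions in
      \<open>delayed\<close>.\<close>
    then have "(\<Sum>l\<le>k. (H l *\<^sub>v (v (k - l) @\<^sub>v w (k - l))) $ i) =
        (if lag i \<le> k then (v (k - lag i) @\<^sub>v w (k - lag i)) $ src i else 0)"
      by simp
    also have "\<dots> = fir_filter m N v w k $ i"
    proof (cases "i < ?n")
      case True
      then show ?thesis
        using m dims app by (auto simp: fir_filter_def delay_stack_def delayed_def lag_def src_def)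
    next
      case False
      \<comment> \<open>The second half of the output carries \<open>w\<close>. Since
        \<open>?n\<close> is a multiple of \<open>m\<close>, removing the offset \<open>?n\<close>
        preserves the residue that selects the component.\<close>
      then obtain i' where i': "i = ?n + i'" "i' < ?n"
        using i by (metis add_less_cancel_left le_add_diff_inverse mult_2 not_le)
      moreover have "i mod m = i' mod m"
        unfolding i' by (metis mod_mult_self4)
      ultimately show ?thesis
        using m dims app
        by (auto simp: fir_filter_def delay_stack_def delayed_def lag_def src_def)
    qed
    finally show "fir_filter m N v w k $ i =
        vec (2 * ?n) (\<lambda>i. \<Sum>l\<le>k. (H l *\<^sub>v (v (k - l) @\<^sub>v w (k - l))) $ i) $ i"
      using i by simp
  qed (simp add: fir_filter_def delay_stack_def)
  have n: "2 * m * (N + 1) = 2 * ?n" by simp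
  have "\<forall>k. H k \<in> carrier_mat (2 * ?n) (2 * m)" by (simp add: H_def)
  with rat conv show ?thesis
    unfolding stable_rational_filter_def n by blast
qed

theorem lemma5:
  fixes m N :: nat
    and Q1 Q2 :: "nat \<Rightarrow> real mat"
    and Q3 :: "int \<Rightarrow> real mat"
  assumes "m \<ge> 1"
    and "\<And>i. i \<le> N \<Longrightarrow> Q1 i \<in> carrier_mat m m \<and> nonneg_mat (Q1 i)"
    and "\<And>i. i \<le> N \<Longrightarrow> Q2 i \<in> carrier_mat m m \<and> nonneg_mat (Q2 i)"
    and "\<And>i. - int N \<le> i \<Longrightarrow> i \<le> int N \<Longrightarrow> i \<noteq> 0 \<Longrightarrow> Q3 i \<in> carrier_mat m m \<and> nonneg_mat (Q3 i)"
    and "Q3 0 \<in> carrier_mat m m" and "metzler (Q3 0)"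
  shows "satisfies_hard_iqc m (2 * m * (N + 1)) repeated_relu (fir_filter m N)
           (relu_iqc_mat m N Q1 Q2 Q3)"
proof -
  let ?n = "m * (N + 1)"
  define M1 where "M1 = bordered_mat m N Q1 Q1"
  define M2 where "M2 = bordered_mat m N Q2 Q2"
  define M3 where "M3 = bordered_mat m N (\<lambda>i. Q3 (int i)) (\<lambda>i. Q3 (- int i))"
  have M: "relu_iqc_mat m N Q1 Q2 Q3 =
      four_block_mat M1 (- M3\<^sup>T - M1) (- M3 - M1) (M1 + M2 + M3 + M3\<^sup>T)"
    by (simp add: relu_iqc_mat_def M1_def M2_def M3_def Let_def)
  have c: "M1 \<in> carrier_mat ?n ?n" "M2 \<in> carrier_mat ?n ?n" "M3 \<in> carrier_mat ?n ?n"
    unfolding M1_def M2_def M3_def by (rule bordered_mat_carrier)+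
  have M1: "nonneg_mat M1" and M2: "nonneg_mat M2"
    unfolding M1_def M2_def using assms by (auto intro!: bordered_mat_nonneg)
  have M3: "metzler M3"
    unfolding M3_def using assms by (intro bordered_mat_metzler) auto
  \<comment> \<open>Non-negativity holds for each time \<open>k\<close> separately, so every partial
    sum is non-negative and the IQC is hard.\<close>
  have "0 \<le> fir_filter m N v (repeated_relu v) k \<bullet>
      (relu_iqc_mat m N Q1 Q2 Q3 *\<^sub>v fir_filter m N v (repeated_relu v) k)"
    if v: "v \<in> ell2e m" for v k
  proof -
    define V where "V = delay_stack m N v k"
    define W where "W = delay_stack m N (repeated_relu v) k"
    have cV: "V \<in> carrier_vec ?n" and cW: "W \<in> carrier_vec ?n"
      unfolding V_def W_def by (rule delay_stack_carrier)+
    have W: "W $ s = relu (V $ s)" if "s < ?n" for s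
      unfolding V_def W_def using delay_stack_repeated_relu[OF assms(1) v that] .
    have U: "(W - V) $ s = relu (V $ s) - V $ s" if "s < ?n" for s
      using that cV W[OF that] by auto
    have cU: "W - V \<in> carrier_vec ?n" using cV cW by simp
    \<comment> \<open>Entrywise, \<open>W\<close> is the positive part of \<open>V\<close> and
      \<open>W - V\<close> its negative part; at most one of them is nonzero.\<close>
    have W0: "0 \<le> W $ s" and U0: "0 \<le> (W - V) $ s" and WU: "W $ s * (W - V) $ s = 0"
      if "s < ?n" for s
      unfolding W[OF that] U[OF that] by (auto simp: relu_def)
    have "0 \<le> (W - V) \<bullet> (M1 *\<^sub>v (W - V))" "0 \<le> W \<bullet> (M2 *\<^sub>v W)" "0 \<le> W \<bullet> (M3 *\<^sub>v (W - V))"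
      using nonneg_form_nonneg[OF c(1) M1 cU U0 cU U0] nonneg_form_nonneg[OF c(2) M2 cW W0 cW W0]
        metzler_form_nonneg[OF c(3) M3 cW W0 cU U0 WU] by blast+
    then show ?thesis
      unfolding M fir_filter_def V_def[symmetric] W_def[symmetric] block_form_expand[OF c cV cW]
      by simp
  qed
  moreover have "relu_iqc_mat m N Q1 Q2 Q3 \<in> carrier_mat (2 * m * (N + 1)) (2 * m * (N + 1))"
  proof -
    have "2 * m * (N + 1) = ?n + ?n" by simp
    then show ?thesis
      unfolding M using c by (metis add_carrier_mat four_block_carrier_mat transpose_carrier_mat)
  qed
  ultimately show ?thesis
    unfolding satisfies_hard_iqc_def using fir_filter_stable[OF assms(1)]
    by (auto intro!: sum_nonneg)
qed

end
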